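(* Let $s\geq0$ be real, let $n$ be an integer with $1\leq n\leq 2+2s$ and $1+s-\frac n2\in\mathbb{N}_0=\{0,1,2,\dots\}$, and let $\kappa\geq0$ be real with $\lfloor\kappa\rfloor=2+s-\frac n2$. Let $u$ be the solution of $u_{tt}-\Delta u=0$ in $(0,\infty)\times\mathbb{R}^n$, $(u,u_t)(0,\cdot)=(u_0,u_1)$, where $u_0\in L^2$ and $\nabla^s u_1\in L^2\cap L^{1,\kappa}$. Assume that for multi-indices $\alpha\in\mathbb{N}_0^n$ $$\int_{\mathbb{R}^n}x^\alpha\,\nabla^s u_1(x)\,dx\ \begin{cases}=0&\text{if } |\alpha|<\lfloor\kappa\rfloor-1,\\ \neq0&\text{if } |\alpha|=\lfloor\kappa\rfloor-1.\end{cases}$$ Then there are constants $c,T>0$ independent of $t$ (possibly depending on $n,s,\kappa$ and the data) such that $$\|u(t,\cdot)\|_{L^2}\geq c\,\sqrt{\ln t}\;\big|P_{x^{\lfloor\kappa\rfloor-1}\nabla^s u_1}\big|\qquad\text{for all } t\geq T;$$ in particular $\|u(t,\cdot)\|_{L^2}\to+\infty$ as $t\to+\infty$.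
   Context: All function spaces are over $\mathbb{R}^n$; $\hat f$ is the Fourier transform. $L^{1,\kappa}:=\{f\in L^1:\|(1+|x|)^\kappa f\|_{L^1}<\infty\}$; $\lfloor\cdot\rfloor$ is the floor function. For real $s\geq0$, $\nabla^s$ is the Fourier multiplier with symbol $|\xi|^s$: "$\nabla^s u_1\in X$" means that $\hat u_1$ is a measurable function such that $|\xi|^s\hat u_1(\xi)$ is the Fourier transform of a function in $X$, denoted $\nabla^s u_1$. For an integer $k\geq0$, $P_{x^kf}$ denotes the vector of $k$-th order moments $\big(\int_{\mathbb{R}^n}x^\alpha f(x)\,dx\big)_{|\alpha|=k}$ and $|\cdot|$ its Euclidean norm. The solution is understood through its Fourier representation $\hat u(t,\xi)=\cos(|\xi|t)\,\hat u_0(\xi)+\frac{\sin(|\xi|t)}{|\xi|}\hat u_1(\xi)$, and $\|u(t,\cdot)\|_{L^2}$ is computed from $\hat u(t,\cdot)$ by Plancherel. *)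

theory Defs
  imports "HOL-Analysis.Analysis"
begin

definition L2 :: "(real ^ 'n \<Rightarrow> complex) set" where
  "L2 = {f \<in> borel_measurable lebesgue. integrable lebesgue (\<lambda>x. (norm (f x))\<^sup>2)}"

definition L2_norm :: "(real ^ 'n \<Rightarrow> complex) \<Rightarrow> real" where
  "L2_norm f = sqrt (LINT x|lebesgue. (norm (f x))\<^sup>2)"

definition weighted_L1 :: "real \<Rightarrow> (real ^ 'n \<Rightarrow> complex) set" where
  "weighted_L1 \<kappa> = {f. integrable lebesgue f \<and>
     integrable lebesgue (\<lambda>x. (1 + norm x) powr \<kappa> *\<^sub>R f x)}"

text \<open>The normalisation makes the Fourier transform unitary on \<open>L2\<close>, so that
  \<open>L2_norm\<close> of the Fourier transform is \<open>L2_norm\<close> of the function.\<close>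

definition fourier_integral :: "(real ^ 'n \<Rightarrow> complex) \<Rightarrow> real ^ 'n \<Rightarrow> complex" where
  "fourier_integral f \<xi> =
     (2 * pi) powr (- real CARD('n) / 2) *\<^sub>R (LINT x|lebesgue. cis (- (x \<bullet> \<xi>)) * f x)"

text \<open>Plancherel's Fourier transform on \<open>L2\<close>, as a relation (it determines \<open>F\<close> up to null sets):
  \<open>F\<close> is the limit in \<open>L2\<close> of the Fourier integrals of \<open>f\<close> over the balls of radius \<open>R\<close>.
  For integrable \<open>f\<close> it agrees with \<open>fourier_integral f\<close> almost everywhere. The distance
  is measured by the nonnegative integral, which is infinite (rather than 0) if it diverges.\<close>

definition has_fourier_transform ::
    "(real ^ 'n \<Rightarrow> complex) \<Rightarrow> (real ^ 'n \<Rightarrow> complex) \<Rightarrow> bool" where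
  "has_fourier_transform f F \<longleftrightarrow> f \<in> L2 \<and> F \<in> L2 \<and>
     ((\<lambda>R::real. \<integral>\<^sup>+ \<xi>. ennreal ((norm
         (F \<xi> - fourier_integral (\<lambda>x. indicator (cball 0 R) x *\<^sub>R f x) \<xi>))\<^sup>2) \<partial>lebesgue)
       \<longlongrightarrow> 0) at_top"

text \<open>\<open>has_nabla_power s v_hat g\<close>: the object with Fourier transform \<open>v_hat\<close> has \<open>g\<close> as its
  image under the Fourier multiplier with symbol \<open>norm \<xi> powr s\<close>. Only the measurable function
  \<open>v_hat\<close> enters, so \<open>v\<close> itself need not be a function. The value \<open>0 powr 0 = 0\<close> (for
  \<open>s = 0\<close>) concerns only the null set \<open>{0}\<close>.\<close>

definition has_nabla_power ::
    "real \<Rightarrow> (real ^ 'n \<Rightarrow> complex) \<Rightarrow> (real ^ 'n \<Rightarrow> complex) \<Rightarrow> bool" where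
  "has_nabla_power s v_hat g \<longleftrightarrow> v_hat \<in> borel_measurable lebesgue \<and>
     has_fourier_transform g (\<lambda>\<xi>. (norm \<xi> powr s) *\<^sub>R v_hat \<xi>)"

definition multi_order :: "('n::finite \<Rightarrow> nat) \<Rightarrow> nat" where
  "multi_order \<alpha> = (\<Sum>i\<in>UNIV. \<alpha> i)"

definition moment :: "('n::finite \<Rightarrow> nat) \<Rightarrow> (real ^ 'n \<Rightarrow> complex) \<Rightarrow> complex" where
  "moment \<alpha> f = (LINT x|lebesgue. (\<Prod>i\<in>UNIV. (x $ i) ^ \<alpha> i) *\<^sub>R f x)"

lemma finite_multi_order: "finite {\<alpha> :: 'n::finite \<Rightarrow> nat. multi_order \<alpha> = k}"
proof (rule finite_subset)
  show "{\<alpha> :: 'n \<Rightarrow> nat. multi_order \<alpha> = k} \<subseteq> (UNIV :: 'n set) \<rightarrow>\<^sub>E {..k}"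
    by (auto simp: multi_order_def intro!: member_le_sum)
  show "finite ((UNIV :: 'n set) \<rightarrow>\<^sub>E {..k})"
    by (intro finite_PiE) auto
qed

definition moment_vector_norm :: "nat \<Rightarrow> (real ^ 'n \<Rightarrow> complex) \<Rightarrow> real" where
  "moment_vector_norm k f = L2_set (\<lambda>\<alpha>. norm (moment \<alpha> f)) {\<alpha>. multi_order \<alpha> = k}"

text \<open>Fourier transform of the solution of the wave equation at time \<open>t\<close>; the point
  \<open>\<xi> = 0\<close>, where Isabelle's division gives 0, is a null set.\<close>

definition wave_hat ::
    "(real ^ 'n \<Rightarrow> complex) \<Rightarrow> (real ^ 'n \<Rightarrow> complex) \<Rightarrow> real \<Rightarrow> real ^ 'n \<Rightarrow> complex" where
  "wave_hat u0_hat u1_hat t \<xi> =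
     cos (norm \<xi> * t) *\<^sub>R u0_hat \<xi> + (sin (norm \<xi> * t) / norm \<xi>) *\<^sub>R u1_hat \<xi>"

end

theory Submission
  imports Defs "HOL-Probability.Characteristic_Functions"
begin

text \<open>Put \<open>k = \<lfloor>\<kappa>\<rfloor> - 1\<close> and let \<open>G\<close> be the Fourier transform of \<open>g = nabla_s_u1\<close>. Since the moments
  below order \<open>k\<close> vanish, expanding the exponential gives \<open>G(\<xi>) = c Q(\<xi>) + O(|\<xi>|^(k+1))\<close> with the
  \<open>k\<close>-homogeneous polynomial \<open>Q(\<xi>) = \<integral> (x \<bullet> \<xi>)^k g(x) dx\<close>, which is not identically zero because
  polarization recovers the moments of order \<open>k\<close> from it. Hence \<open>|G(\<xi>)| \<ge> q |\<xi>|^k\<close> near \<open>0\<close> in an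
  open cone \<open>C\<close>. Since \<open>2 + 2s = 2k + n\<close>, the squared velocity part of the solution is there at least
  \<open>q^2 sin^2(|\<xi>|t) / |\<xi>|^n\<close>. On the shells of \<open>C\<close> where \<open>|\<xi>|t\<close> lies between \<open>m pi + pi/6\<close> and
  \<open>m pi + 5 pi/6\<close> we have \<open>sin^2 \<ge> 1/4\<close>, and the homogeneity of Lebesgue measure bounds the integral
  over the \<open>m\<close>-th shell below by a multiple of \<open>1/(m + 1)\<close>. The resulting harmonic sum over
  \<open>m < \<delta>t/pi\<close> is the logarithm; the displacement part stays bounded in \<open>L2\<close>.\<close>

section \<open>Fourier transform of integrable functions\<close>

text \<open>Dominated convergence along sequences. A convergent sequence is bounded, so the majorant
  may depend on the radius \<open>R\<close>; this admits integrands growing polynomially in the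
  parameter, as moments do.\<close>

lemma continuous_on_parametric_integral:
  fixes F :: "'b::real_normed_vector \<Rightarrow> 'a \<Rightarrow> 'c::{banach, second_countable_topology}"
  assumes meas: "\<And>\<xi>. F \<xi> \<in> borel_measurable M"
    and cont: "\<And>x. continuous_on UNIV (\<lambda>\<xi>. F \<xi> x)"
    and bound: "\<And>R \<xi> x. norm \<xi> \<le> R \<Longrightarrow> norm (F \<xi> x) \<le> b R x"
    and int: "\<And>R. integrable M (b R)"
  shows "continuous_on UNIV (\<lambda>\<xi>. LINT x|M. F \<xi> x)"
proof -
  have "(\<lambda>n. LINT x|M. F (X n) x) \<longlonglongrightarrow> (LINT x|M. F a x)" if X: "X \<longlonglongrightarrow> a" for X a
  proof -
    have "Bseq X"
      using X convergentI convergent_imp_Bseq by blast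
    then obtain R where R: "\<And>n. norm (X n) \<le> R"
      by (auto simp: Bseq_def)
    show ?thesis
    proof (rule integral_dominated_convergence)
      show "AE x in M. (\<lambda>n. F (X n) x) \<longlonglongrightarrow> F a x"
        using continuous_on_tendsto_compose[OF cont X] by simp
      show "integrable M (b R)"
        by (rule int)
      show "AE x in M. norm (F (X n) x) \<le> b R x" for n
        using bound[OF R] by simp
    qed (use meas in auto)
  qed
  then show ?thesis
    by (auto simp: continuous_on_sequentially comp_def)
qed

lemma norm_cis_integrand [simp]: "norm (cis a * z) = norm z"
  by (simp add: norm_mult)

lemma borel_measurable_lebesgue_continuous_onI:
  fixes f :: "'a::euclidean_space \<Rightarrow> 'b::topological_space"
  shows "continuous_on UNIV f \<Longrightarrow> f \<in> borel_measurable lebesgue"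
  by (rule measurable_completion) (simp add: borel_measurable_continuous_onI)

lemma cis_inner_measurable [measurable]: "(\<lambda>x. cis (- (x \<bullet> \<xi>))) \<in> borel_measurable lebesgue"
  by (intro borel_measurable_lebesgue_continuous_onI continuous_intros)

lemma continuous_on_fourier_integral:
  assumes f: "integrable lebesgue f"
  shows "continuous_on UNIV (fourier_integral f)"
proof -
  have [measurable]: "f \<in> borel_measurable lebesgue"
    using f by auto
  have "continuous_on UNIV (\<lambda>\<xi>. LINT x|lebesgue. cis (- (x \<bullet> \<xi>)) * f x)"
    by (rule continuous_on_parametric_integral[where b = "\<lambda>_ x. norm (f x)"])
       (use f in \<open>auto intro!: continuous_intros\<close>)
  then show ?thesis
    unfolding fourier_integral_def [abs_def] by (intro continuous_intros)
qed

lemma fourier_integral_cutoff_tendsto: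
  assumes f: "integrable lebesgue f"
  shows "(\<lambda>N::nat. fourier_integral (\<lambda>x. indicator (cball 0 (real N)) x *\<^sub>R f x) \<xi>)
           \<longlonglongrightarrow> fourier_integral f \<xi>"
proof -
  have "(\<lambda>N. LINT x|lebesgue. cis (- (x \<bullet> \<xi>)) * (indicator (cball 0 (real N)) x *\<^sub>R f x))
      \<longlonglongrightarrow> (LINT x|lebesgue. cis (- (x \<bullet> \<xi>)) * f x)"
  proof (rule integral_dominated_convergence[where w = "\<lambda>x. norm (f x)"])
    have [measurable]: "f \<in> borel_measurable lebesgue"
      using f by auto
    show "(\<lambda>x. cis (- (x \<bullet> \<xi>)) * f x) \<in> borel_measurable lebesgue"
      by measurable
    show "(\<lambda>x. cis (- (x \<bullet> \<xi>)) * (indicator (cball 0 (real N)) x *\<^sub>R f x)) \<in> borel_measurable lebesgue" for N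
      by (rule borel_measurable_times[OF cis_inner_measurable
            borel_measurable_integrable[OF integrable_mult_indicator[OF _ f]]]) simp
    show "integrable lebesgue (\<lambda>x. norm (f x))"
      using f by simp
    show "AE x in lebesgue. norm (cis (- (x \<bullet> \<xi>)) * (indicator (cball 0 (real N)) x *\<^sub>R f x)) \<le> norm (f x)" for N
      by (auto simp: indicator_def)
    show "AE x in lebesgue. (\<lambda>N. cis (- (x \<bullet> \<xi>)) * (indicator (cball 0 (real N)) x *\<^sub>R f x))
            \<longlonglongrightarrow> cis (- (x \<bullet> \<xi>)) * f x"
    proof (intro AE_I2 tendsto_eventually)
      fix x :: "real ^ 'a"
      obtain N0 :: nat where "norm x \<le> real N0"
        using real_arch_simple by blast
      then have "cis (- (x \<bullet> \<xi>)) * (indicator (cball 0 (real N)) x *\<^sub>R f x) = cis (- (x \<bullet> \<xi>)) * f x"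
        if "N \<ge> N0" for N
        using that by (auto simp: indicator_def)
      then show "\<forall>\<^sub>F N in sequentially.
          cis (- (x \<bullet> \<xi>)) * (indicator (cball 0 (real N)) x *\<^sub>R f x) = cis (- (x \<bullet> \<xi>)) * f x"
        using eventually_sequentially by blast
    qed
  qed
  then show ?thesis
    unfolding fourier_integral_def by (intro tendsto_scaleR tendsto_const)
qed

text \<open>The transforms of the truncations converge to \<open>F\<close> in mean square and, by
  dominated convergence, pointwise to the Fourier integral. Fatou's lemma then makes the mean square
  distance of the two limits zero.\<close>

lemma has_fourier_transform_integrable_AE:
  assumes F: "has_fourier_transform f F" and f: "integrable lebesgue f"
  shows "AE \<xi> in lebesgue. F \<xi> = fourier_integral f \<xi>"
proof -
  define G where "G = (\<lambda>(N::nat). fourier_integral (\<lambda>x. indicator (cball 0 (real N)) x *\<^sub>R f x))"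
  have lim: "(\<lambda>N. \<integral>\<^sup>+ \<xi>. ennreal ((norm (F \<xi> - G N \<xi>))\<^sup>2) \<partial>lebesgue) \<longlonglongrightarrow> 0"
    using F filterlim_compose[OF _ filterlim_real_sequentially]
    unfolding has_fourier_transform_def G_def by blast
  have [measurable]: "F \<in> borel_measurable lebesgue"
    using F by (auto simp: has_fourier_transform_def L2_def)
  have "continuous_on UNIV (G N)" for N
    unfolding G_def
    by (rule continuous_on_fourier_integral, rule integrable_mult_indicator) (use f in auto)
  then have [measurable]: "G N \<in> borel_measurable lebesgue" for N
    by (rule borel_measurable_lebesgue_continuous_onI)
  define H where "H = fourier_integral f"
  have [measurable]: "H \<in> borel_measurable lebesgue"
    unfolding H_def by (intro borel_measurable_lebesgue_continuous_onI continuous_on_fourier_integral f)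
  have "(\<integral>\<^sup>+ \<xi>. ennreal ((norm (F \<xi> - H \<xi>))\<^sup>2) \<partial>lebesgue)
      = (\<integral>\<^sup>+ \<xi>. liminf (\<lambda>N. ennreal ((norm (F \<xi> - G N \<xi>))\<^sup>2)) \<partial>lebesgue)"
  proof (intro nn_integral_cong lim_imp_Liminf[symmetric])
    fix \<xi>
    show "(\<lambda>N. ennreal ((norm (F \<xi> - G N \<xi>))\<^sup>2)) \<longlonglongrightarrow> ennreal ((norm (F \<xi> - H \<xi>))\<^sup>2)"
      unfolding G_def H_def by (intro tendsto_intros fourier_integral_cutoff_tendsto f)
  qed auto
  also have "\<dots> \<le> liminf (\<lambda>N. \<integral>\<^sup>+ \<xi>. ennreal ((norm (F \<xi> - G N \<xi>))\<^sup>2) \<partial>lebesgue)"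
    by (rule nn_integral_liminf) measurable
  also have "\<dots> = 0"
    using lim by (intro lim_imp_Liminf) auto
  finally have int0: "(\<integral>\<^sup>+ \<xi>. ennreal ((norm (F \<xi> - H \<xi>))\<^sup>2) \<partial>lebesgue) = 0"
    unfolding le_zero_eq .
  have meas: "(\<lambda>\<xi>. ennreal ((norm (F \<xi> - H \<xi>))\<^sup>2)) \<in> borel_measurable lebesgue"
    by measurable
  have "AE \<xi> in lebesgue. ennreal ((norm (F \<xi> - H \<xi>))\<^sup>2) = 0"
    using int0 unfolding nn_integral_0_iff_AE[OF meas] .
  then show ?thesis
    by (simp add: H_def)
qed

section \<open>Moments and polarization\<close>

text \<open>Interpolates between the directional moments (\<open>\<beta> = 0\<close>), which are the
  Taylor terms of the Fourier transform, and the ordinary moments (\<open>j = 0\<close>). Expansion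
  and polarization both preserve the total order \<open>j + multi_order \<beta>\<close>.\<close>

definition mixed_moment :: "(real ^ 'n \<Rightarrow> complex) \<Rightarrow> nat \<Rightarrow> real ^ 'n \<Rightarrow> ('n \<Rightarrow> nat) \<Rightarrow> complex" where
  "mixed_moment g j v \<beta> = (LINT x|lebesgue. ((x \<bullet> v) ^ j * (\<Prod>i\<in>UNIV. (x $ i) ^ \<beta> i)) *\<^sub>R g x)"

lemma monomial_upd_add:
  fixes x :: "real ^ 'n"
  shows "(\<Prod>i\<in>UNIV. (x $ i) ^ (\<beta>(l := \<beta> l + m)) i) = (x $ l) ^ m * (\<Prod>i\<in>UNIV. (x $ i) ^ \<beta> i)"
  by (simp add: prod.remove[of UNIV l] power_add mult_ac)

lemma multi_order_upd_add: "multi_order (\<beta>(l := \<beta> l + m)) = multi_order \<beta> + m"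
  by (simp add: multi_order_def sum.remove[of UNIV l])

lemma multi_order_upd_Suc [simp]: "multi_order (\<beta>(l := Suc (\<beta> l))) = Suc (multi_order \<beta>)"
  using multi_order_upd_add[of \<beta> l 1] by simp

lemma abs_monomial_le:
  fixes x :: "real ^ 'n"
  shows "\<bar>\<Prod>i\<in>UNIV. (x $ i) ^ \<beta> i\<bar> \<le> norm x ^ multi_order \<beta>"
proof -
  have "\<bar>\<Prod>i\<in>UNIV. (x $ i) ^ \<beta> i\<bar> = (\<Prod>i\<in>UNIV. \<bar>x $ i\<bar> ^ \<beta> i)"
    by (simp add: abs_prod power_abs)
  also have "\<dots> \<le> (\<Prod>i\<in>UNIV. norm x ^ \<beta> i)"
    by (intro prod_mono conjI power_mono component_le_norm_cart) auto
  also have "\<dots> = norm x ^ multi_order \<beta>"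
    by (simp add: multi_order_def power_sum)
  finally show ?thesis .
qed

lemma inner_power_monomial_measurable [measurable]:
  "(\<lambda>x :: real ^ 'n. (x \<bullet> v) ^ j * (\<Prod>i\<in>UNIV. (x $ i) ^ \<beta> i)) \<in> borel_measurable lebesgue"
  by (intro borel_measurable_lebesgue_continuous_onI continuous_intros)

text \<open>The single weight \<open>(1 + norm x) ^ k\<close> dominates the integrands of all mixed
  moments of total order at most \<open>k\<close>.\<close>

locale finite_moments =
  fixes g :: "real ^ 'n \<Rightarrow> complex" and k :: nat
  assumes measurable_density [measurable]: "g \<in> borel_measurable lebesgue"
    and integrable_weight: "integrable lebesgue (\<lambda>x. (1 + norm x) ^ k * norm (g x))"
begin

lemma norm_mixed_integrand_le:
  assumes "j + multi_order \<beta> \<le> k"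
  shows "norm (((x \<bullet> v) ^ j * (\<Prod>i\<in>UNIV. (x $ i) ^ \<beta> i)) *\<^sub>R g x)
           \<le> norm v ^ j * ((1 + norm x) ^ k * norm (g x))"
proof -
  have "\<bar>(x \<bullet> v) ^ j * (\<Prod>i\<in>UNIV. (x $ i) ^ \<beta> i)\<bar>
      = \<bar>x \<bullet> v\<bar> ^ j * \<bar>\<Prod>i\<in>UNIV. (x $ i) ^ \<beta> i\<bar>"
    by (simp add: abs_mult power_abs)
  also have "\<dots> \<le> (norm x * norm v) ^ j * norm x ^ multi_order \<beta>"
    by (intro mult_mono power_mono Cauchy_Schwarz_ineq2 abs_monomial_le) auto
  also have "\<dots> = norm v ^ j * norm x ^ (j + multi_order \<beta>)"
    by (simp add: power_mult_distrib power_add)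
  also have "\<dots> \<le> norm v ^ j * (1 + norm x) ^ (j + multi_order \<beta>)"
    by (intro mult_left_mono power_mono) auto
  also have "\<dots> \<le> norm v ^ j * (1 + norm x) ^ k"
    using assms by (intro mult_left_mono power_increasing) auto
  finally show ?thesis
    by (simp add: mult_right_mono flip: mult.assoc)
qed

lemma integrable_mixed:
  assumes "j + multi_order \<beta> \<le> k"
  shows "integrable lebesgue (\<lambda>x. ((x \<bullet> v) ^ j * (\<Prod>i\<in>UNIV. (x $ i) ^ \<beta> i)) *\<^sub>R g x)"
proof (rule Bochner_Integration.integrable_bound)
  show "integrable lebesgue (\<lambda>x. norm v ^ j * ((1 + norm x) ^ k * norm (g x)))"
    using integrable_weight by (rule integrable_mult_right)
  show "AE x in lebesgue. norm (((x \<bullet> v) ^ j * (\<Prod>i\<in>UNIV. (x $ i) ^ \<beta> i)) *\<^sub>R g x)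
      \<le> norm (norm v ^ j * ((1 + norm x) ^ k * norm (g x)))"
    using norm_mixed_integrand_le[OF assms] by (auto intro!: AE_I2 order_trans)
qed measurable

text \<open>Induction on \<open>j\<close>: one factor \<open>x \<bullet> v\<close> is written as the
  sum of the \<open>v $ l * x $ l\<close>, and each \<open>x $ l\<close> moves into the
  monomial.\<close>

lemma mixed_moment_eq_0:
  assumes "j + multi_order \<beta> \<le> k"
    and "\<And>\<alpha>. multi_order \<alpha> = j + multi_order \<beta> \<Longrightarrow> moment \<alpha> g = 0"
  shows "mixed_moment g j v \<beta> = 0"
  using assms
proof (induction j arbitrary: \<beta>)
  case 0
  then show ?case
    by (simp add: mixed_moment_def moment_def)
next
  case (Suc j)
  have "((x \<bullet> v) ^ Suc j * (\<Prod>i\<in>UNIV. (x $ i) ^ \<beta> i)) *\<^sub>R g x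
      = (\<Sum>l\<in>UNIV. v $ l *\<^sub>R (((x \<bullet> v) ^ j * (\<Prod>i\<in>UNIV. (x $ i) ^ (\<beta>(l := \<beta> l + 1)) i)) *\<^sub>R g x))" for x
    by (subst monomial_upd_add)
       (simp add: inner_vec_def sum_distrib_left sum_distrib_right mult_ac flip: scaleR_sum_left)
  then have "mixed_moment g (Suc j) v \<beta> = (LINT x|lebesgue.
      (\<Sum>l\<in>UNIV. v $ l *\<^sub>R (((x \<bullet> v) ^ j * (\<Prod>i\<in>UNIV. (x $ i) ^ (\<beta>(l := \<beta> l + 1)) i)) *\<^sub>R g x)))"
    by (simp only: mixed_moment_def)
  also have "\<dots> = (\<Sum>l\<in>UNIV. v $ l *\<^sub>R mixed_moment g j v (\<beta>(l := \<beta> l + 1)))"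
    unfolding mixed_moment_def using Suc.prems(1)
    by (subst Bochner_Integration.integral_sum)
       (auto simp del: scaleR_scaleR fun_upd_apply Suc_eq_plus1
         intro!: integrable_scaleR_right integrable_mixed simp: multi_order_upd_add)
  also have "\<dots> = 0"
  proof -
    have "mixed_moment g j v (\<beta>(l := \<beta> l + 1)) = 0" for l
      using Suc.prems by (intro Suc.IH) (simp_all add: multi_order_upd_add del: fun_upd_apply)
    then show ?thesis
      by simp
  qed
  finally show ?case .
qed

text \<open>Polarization: the coefficient of \<open>t\<close> in the polynomial
  \<open>t \<mapsto> mixed_moment g (Suc j) (v + t *\<^sub>R axis l 1) \<beta>\<close> trades one factor \<open>x \<bullet> v\<close>
  for a factor \<open>x $ l\<close>.\<close>

lemma mixed_moment_polarize:
  assumes k: "Suc j + multi_order \<beta> \<le> k"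
    and zero: "\<And>v. mixed_moment g (Suc j) v \<beta> = 0"
  shows "mixed_moment g j v (\<beta>(l := \<beta> l + 1)) = 0"
proof -
  \<comment> \<open>Coefficients in \<open>t\<close> after binomial expansion of
    \<open>(t * x $ l + x \<bullet> v) ^ Suc j\<close>. The linear one, \<open>c 1\<close>, is
    \<open>Suc j\<close> times the mixed moment to be killed.\<close>
  define c where "c i = of_nat (Suc j choose i) * mixed_moment g (Suc j - i) v (\<beta>(l := \<beta> l + i))" for i
  have "(\<Sum>i\<le>Suc j. c i * of_real t ^ i) = 0" for t :: real
  proof -
    have "((x \<bullet> (v + t *\<^sub>R axis l 1)) ^ Suc j * (\<Prod>i\<in>UNIV. (x $ i) ^ \<beta> i)) *\<^sub>R g x
      = (\<Sum>i\<le>Suc j. (of_nat (Suc j choose i) * t ^ i) *\<^sub>R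
          (((x \<bullet> v) ^ (Suc j - i) * (\<Prod>m\<in>UNIV. (x $ m) ^ (\<beta>(l := \<beta> l + i)) m)) *\<^sub>R g x))" for x
    proof -
      have "(x \<bullet> (v + t *\<^sub>R axis l 1)) ^ Suc j = (t * x $ l + x \<bullet> v) ^ Suc j"
        by (simp add: inner_add_right inner_axis algebra_simps)
      also have "\<dots> = (\<Sum>i\<le>Suc j. of_nat (Suc j choose i) * (t * x $ l) ^ i * (x \<bullet> v) ^ (Suc j - i))"
        by (rule binomial_ring)
      finally show ?thesis
        unfolding monomial_upd_add
        by (simp only: sum_distrib_left sum_distrib_right scaleR_sum_left scaleR_scaleR power_mult_distrib mult_ac)
    qed
    then have "mixed_moment g (Suc j) (v + t *\<^sub>R axis l 1) \<beta>
       = (LINT x|lebesgue. (\<Sum>i\<le>Suc j. (of_nat (Suc j choose i) * t ^ i) *\<^sub>R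
          (((x \<bullet> v) ^ (Suc j - i) * (\<Prod>m\<in>UNIV. (x $ m) ^ (\<beta>(l := \<beta> l + i)) m)) *\<^sub>R g x)))"
      by (simp only: mixed_moment_def)
    also have "\<dots> = (\<Sum>i\<le>Suc j. (of_nat (Suc j choose i) * t ^ i) *\<^sub>R
          mixed_moment g (Suc j - i) v (\<beta>(l := \<beta> l + i)))"
      unfolding mixed_moment_def using k
      by (subst Bochner_Integration.integral_sum)
         (auto simp del: scaleR_scaleR fun_upd_apply
           intro!: integrable_scaleR_right integrable_mixed simp: multi_order_upd_add)
    also have "\<dots> = (\<Sum>i\<le>Suc j. c i * of_real t ^ i)"
      by (intro sum.cong) (auto simp: c_def scaleR_conv_of_real mult_ac)
    finally show ?thesis
      using zero by simp
  qed
  \<comment> \<open>The polynomial vanishes at every real number, hence at infinitely many points,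
    so all its coefficients are zero.\<close>
  then have "range (of_real :: real \<Rightarrow> complex) \<subseteq> {z. (\<Sum>i\<le>Suc j. c i * z ^ i) = 0}"
    by auto
  moreover have "infinite (range (of_real :: real \<Rightarrow> complex))"
    using finite_imageD[of "of_real :: real \<Rightarrow> complex" UNIV]
    by (auto simp: inj_on_def infinite_UNIV_char_0)
  ultimately have "infinite {z. (\<Sum>i\<le>Suc j. c i * z ^ i) = 0}"
    using infinite_super by blast
  then have "c 1 = 0"
    using polyfun_rootbound_finite[of "Suc j" c] by auto
  then show ?thesis
    by (simp add: c_def del: fun_upd_apply of_nat_Suc)
qed

text \<open>Repeated polarization turns all \<open>m\<close> directional factors into coordinates.
  Its contrapositive later provides a direction in which the leading Taylor term does not
  vanish.\<close>

lemma moment_eq_0_of_directional: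
  assumes zero: "\<And>v. mixed_moment g m v (\<lambda>_. 0) = 0"
    and "multi_order \<alpha> = m" "m \<le> k"
  shows "moment \<alpha> g = 0"
proof -
  \<comment> \<open>Generalized to all splittings of the order \<open>m\<close>: the induction on
    the order of \<open>\<beta>\<close> starts at the hypothesis, and \<open>j = 0\<close> is the
    claim.\<close>
  have "\<forall>v. mixed_moment g j v \<beta> = 0" if "j + multi_order \<beta> = m" for j \<beta>
    using that
  proof (induction "multi_order \<beta>" arbitrary: j \<beta>)
    case 0
    then have "\<beta> = (\<lambda>_. 0)"
      by (auto simp: multi_order_def)
    with 0 zero show ?case
      by simp
  next
    case (Suc n)
    have "\<exists>l. \<beta> l > 0"
    proof (rule ccontr)
      assume "\<nexists>l. \<beta> l > 0"
      then show False
        using Suc.hyps(2) by (simp add: multi_order_def)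
    qed
    then obtain l where l: "\<beta> l > 0" ..
    define \<gamma> where "\<gamma> = \<beta>(l := \<beta> l - 1)"
    have \<beta>: "\<beta> = \<gamma>(l := \<gamma> l + 1)"
      using l by (auto simp: \<gamma>_def)
    have ord: "multi_order \<beta> = multi_order \<gamma> + 1"
      by (subst \<beta>) (rule multi_order_upd_add)
    have "mixed_moment g (Suc j) v \<gamma> = 0" for v
      using Suc ord by simp
    then have "mixed_moment g j v (\<gamma>(l := \<gamma> l + 1)) = 0" for v
      using ord Suc.prems \<open>m \<le> k\<close> by (intro mixed_moment_polarize) auto
    then show ?case
      by (subst \<beta>) blast
  qed
  from this[of 0 \<alpha>] show ?thesis
    using assms(2) by (simp add: mixed_moment_def moment_def)
qed

end

section \<open>Integrals of homogeneous functions\<close>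

text \<open>Dyadic decomposition: where \<open>2^-(j+1) < |x| \<le> 2^-j\<close> the integrand is at
  most \<open>2^((j+1)m)\<close>, while the ball of radius \<open>2^-j\<close> has measure at most a
  constant times \<open>2^-(j(m+1))\<close>. The products form a geometric series.\<close>

lemma integrable_inverse_norm_power_unit_ball:
  assumes "m < DIM('a::euclidean_space)"
  shows "integrable lebesgue (\<lambda>x :: 'a. indicator (cball 0 1) x / norm x ^ m)"
proof (rule integrableI_bounded)
  show "(\<lambda>x :: 'a. indicator (cball 0 1) x / norm x ^ m) \<in> borel_measurable lebesgue"
    by (intro measurable_completion borel_measurable_divide borel_measurable_indicator) auto
  \<comment> \<open>Whole balls replace the dyadic shells; their overlap only enlarges the
    majorant.\<close>
  define f :: "nat \<Rightarrow> 'a \<Rightarrow> ennreal"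
    where "f j = (\<lambda>x. ennreal (2 ^ ((j + 1) * m)) * indicator (cball 0 ((1/2) ^ j)) x)" for j
  have le: "ennreal (norm (indicator (cball 0 1) x / norm x ^ m)) \<le> (\<Sum>j. f j x)" if nz: "x \<noteq> 0" for x :: 'a
  proof (cases "norm x \<le> 1")
    case True
    \<comment> \<open>The first radius below \<open>norm x\<close>. It is not the radius 1, so the
      preceding index \<open>i\<close> exists and gives the shell containing
      \<open>x\<close>.\<close>
    define j where "j = (LEAST j. (1/2) ^ j < norm x)"
    obtain j0 where "(1/2::real) ^ j0 < norm x"
      using real_arch_pow_inv[of "norm x" "1/2"] nz by auto
    then have j: "(1/2) ^ j < norm x" and min: "\<And>i. i < j \<Longrightarrow> norm x \<le> (1/2) ^ i"
      unfolding j_def by (metis (mono_tags) LeastI) (metis not_less_Least not_le_imp_less)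
    from j True have "j \<noteq> 0"
      by (intro notI) simp
    then obtain i where i: "j = Suc i"
      using not0_implies_Suc by blast
    have "inverse (norm x) ^ m \<le> (2 ^ (i + 1)) ^ m"
    proof (rule power_mono)
      have "inverse (norm x) \<le> inverse ((1/2) ^ j)"
        using j by (intro le_imp_inverse_le) auto
      then show "inverse (norm x) \<le> 2 ^ (i + 1)"
        by (simp add: i power_one_over)
    qed auto
    then have "ennreal (norm (indicator (cball 0 1) x / norm x ^ m)) \<le> f i x"
      using True min[of i] i
      by (auto simp: f_def inverse_eq_divide power_one_over power_add power_mult power_mult_distrib intro!: ennreal_leI)
    also have "\<dots> \<le> (\<Sum>j. f j x)"
      using sum_le_suminf[of "\<lambda>j. f j x" "{i}"] by simp
    finally show ?thesis .
  qed auto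
  have ball: "emeasure lebesgue (cball (0::'a) ((1/2) ^ j))
      \<le> ennreal ((1/2) ^ (j * Suc m)) * ennreal (measure lebesgue (cball (0::'a) 1))" for j
  proof -
    have "emeasure lebesgue (cball (0::'a) ((1/2) ^ j)) = emeasure lebesgue ((\<lambda>x. ((1/2) ^ j) *\<^sub>R x + 0) ` cball (0::'a) 1)"
      by (simp add: cball_scale)
    also have "\<dots> = ennreal (((1/2) ^ j) ^ DIM('a)) * emeasure lebesgue (cball (0::'a) 1)"
      using emeasure_lebesgue_affine[of "(1/2) ^ j" "0 :: 'a" "cball 0 1"] by simp
    also have "\<dots> \<le> ennreal (((1/2) ^ j) ^ Suc m) * emeasure lebesgue (cball (0::'a) 1)"
      using assms by (intro mult_right_mono ennreal_leI power_decreasing) (auto simp: power_le_one)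
    finally show ?thesis
      by (simp add: power_mult power_add emeasure_eq_measure2 lmeasurable_cball)
  qed
  have "(\<integral>\<^sup>+ x. ennreal (norm (indicator (cball 0 1) (x :: 'a) / norm x ^ m)) \<partial>lebesgue)
      \<le> (\<integral>\<^sup>+ x. (\<Sum>j. f j x) \<partial>lebesgue)"
  proof (rule nn_integral_mono_AE)
    have "AE x :: 'a in lebesgue. x \<notin> {0}"
      by (rule AE_not_in) simp
    then show "AE x :: 'a in lebesgue. ennreal (norm (indicator (cball 0 1) x / norm x ^ m)) \<le> (\<Sum>j. f j x)"
      by eventually_elim (use le in simp)
  qed
  also have "\<dots> = (\<Sum>j. integral\<^sup>N lebesgue (f j))"
    unfolding f_def
    by (intro nn_integral_suminf borel_measurable_times_ennreal borel_measurable_const borel_measurable_indicator) simp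
  also have "\<dots> \<le> (\<Sum>j. ennreal (2 ^ m * measure lebesgue (cball (0::'a) 1) * (1/2) ^ j))"
  proof (intro suminf_le)
    fix j
    have "integral\<^sup>N lebesgue (f j) = ennreal (2 ^ ((j + 1) * m)) * emeasure lebesgue (cball (0::'a) ((1/2) ^ j))"
      unfolding f_def by (subst nn_integral_cmult_indicator) auto
    also have "\<dots> \<le> ennreal (2 ^ ((j + 1) * m)) * (ennreal ((1/2) ^ (j * Suc m)) * ennreal (measure lebesgue (cball (0::'a) 1)))"
      by (intro mult_left_mono ball) auto
    also have "\<dots> = ennreal (2 ^ ((j + 1) * m) * (1/2) ^ (j * Suc m) * measure lebesgue (cball (0::'a) 1))"
      by (simp add: mult.assoc flip: ennreal_mult)
    also have "2 ^ ((j + 1) * m) * (1/2) ^ (j * Suc m) * measure lebesgue (cball (0::'a) 1)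
      = 2 ^ m * measure lebesgue (cball (0::'a) 1) * (1/2) ^ j"
      by (simp add: power_add power_one_over field_simps)
    finally show "integral\<^sup>N lebesgue (f j) \<le> ennreal (2 ^ m * measure lebesgue (cball (0::'a) 1) * (1/2) ^ j)" .
  qed auto
  also have "\<dots> < \<infinity>"
    by (subst suminf_ennreal2) (auto intro!: summable_mult summable_geometric)
  finally show "(\<integral>\<^sup>+ x. ennreal (norm (indicator (cball 0 1) (x::'a) / norm x ^ m)) \<partial>lebesgue) < \<infinity>" .
qed

section \<open>Logarithmic growth of integrals over a cone\<close>

lemma sin_squared_ge_quarter:
  assumes "real m * pi + pi / 6 \<le> y" "y \<le> real m * pi + 5 * pi / 6"
  shows "1 / 4 \<le> (sin y)\<^sup>2"
proof -
  define z where "z = y - real m * pi"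
  have z: "pi / 6 \<le> z" "z \<le> 5 * pi / 6"
    using assms by (auto simp: z_def)
  have "1 / 2 \<le> sin z"
  proof (cases "z \<le> pi / 2")
    case True
    then show ?thesis
      using sin_monotone_2pi_le[of "pi / 6" z] z by (simp add: sin_30)
  next
    case False
    then show ?thesis
      using sin_monotone_2pi_le[of "pi / 6" "pi - z"] z by (simp add: sin_30)
  qed
  then have "(1 / 2)\<^sup>2 \<le> (sin z)\<^sup>2"
    by (intro power_mono) auto
  moreover have "y = z + real m * pi"
    by (simp add: z_def)
  then have "(sin y)\<^sup>2 = (sin z)\<^sup>2"
    by (simp add: sin_add sin_npi cos_npi power_mult_distrib flip: power_mult)
  ultimately show ?thesis
    by (simp add: power2_eq_square)
qed

text \<open>A cone is invariant under dilation, so its part in the ball of radius \<open>r\<close>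
  is the \<open>r\<close>-dilate of its part in the unit ball.\<close>

lemma measure_cone_Int_ball:
  fixes C :: "'a::euclidean_space set"
  assumes cone: "\<And>r x. r > 0 \<Longrightarrow> x \<in> C \<Longrightarrow> r *\<^sub>R x \<in> C" and r: "r > 0"
  shows "measure lebesgue (C \<inter> ball 0 r) = r ^ DIM('a) * measure lebesgue (C \<inter> ball 0 1)"
proof -
  have "C \<inter> ball 0 r = (\<lambda>x. r *\<^sub>R x + 0) ` (C \<inter> ball 0 1)"
  proof (intro equalityI subsetI)
    fix x
    assume "x \<in> C \<inter> ball 0 r"
    then have "inverse r *\<^sub>R x \<in> C \<inter> ball 0 1" "x = r *\<^sub>R (inverse r *\<^sub>R x) + 0"
      using r cone[of "inverse r" x] by (auto simp: field_simps)
    then show "x \<in> (\<lambda>x. r *\<^sub>R x + 0) ` (C \<inter> ball 0 1)"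
      by blast
  qed (use r cone in auto)
  then show ?thesis
    using measure_lebesgue_affine[of r 0 "C \<inter> ball 0 1"] r by simp
qed

text \<open>The constant \<open>\<nu>\<close> depends on the cone alone and is fixed before
  \<open>\<delta>\<close>, \<open>t\<close>, \<open>p\<close> and \<open>f\<close>, which makes the
  bound uniform in time.\<close>

lemma cone_log_lower_bound:
  fixes C :: "'a::euclidean_space set"
  assumes C: "open C" "C \<noteq> {}"
    and cone: "\<And>r x. r > 0 \<Longrightarrow> x \<in> C \<Longrightarrow> r *\<^sub>R x \<in> C"
  obtains \<nu> where "\<nu> > 0"
    and "\<And>\<delta> t p f. \<lbrakk>\<delta> > 0; t > 0; p \<ge> 0; integrable lebesgue f; \<And>x. 0 \<le> f x;
        AE x in lebesgue. x \<in> C \<longrightarrow> norm x < \<delta> \<longrightarrow> p * (sin (norm x * t))\<^sup>2 / norm x ^ DIM('a) \<le> f x\<rbrakk>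
      \<Longrightarrow> \<nu> * p * ln (\<delta> * t / pi) \<le> (LINT x|lebesgue. f x)"
proof
  let ?n = "DIM('a)"
  define \<mu> where "\<mu> = measure lebesgue (C \<inter> ball 0 1)"
  have lm: "C \<inter> ball 0 r \<in> lmeasurable" for r
    using C(1) by (intro lmeasurable_open bounded_Int) auto
  have scale: "measure lebesgue (C \<inter> ball 0 r) = r ^ ?n * \<mu>" if "r > 0" for r
    unfolding \<mu>_def by (rule measure_cone_Int_ball[OF cone that])
  have "C \<inter> ball 0 1 \<noteq> {}"
  proof -
    obtain x where x: "x \<in> C"
      using C(2) by blast
    have "norm ((1 / (1 + norm x)) *\<^sub>R x) < 1"
      by (simp add: divide_simps add_pos_nonneg)
    moreover have "(1 / (1 + norm x)) *\<^sub>R x \<in> C"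
      using x by (intro cone) (auto simp: add_pos_nonneg)
    ultimately show ?thesis
      by (metis IntI emptyE mem_ball_0)
  qed
  then have "\<not> negligible (C \<inter> ball 0 1)"
    using C(1) by (intro open_not_negligible) auto
  then have \<mu>: "\<mu> > 0"
    using lm negligible_iff_measure unfolding \<mu>_def
    by (metis measure_nonneg order_le_less)
  \<comment> \<open>The factor 1/6 is 1/4, the lower bound for \<open>sin^2\<close> on the shells,
    times 2/3, which comes from the width of the phase interval in units of
    \<open>pi\<close>.\<close>
  then show "\<mu> / 6 > 0"
    by simp

  fix \<delta> t p :: real and f :: "'a \<Rightarrow> real"
  assume \<delta>: "\<delta> > 0" and t: "t > 0" and p: "p \<ge> 0" and f: "integrable lebesgue f" "\<And>x. 0 \<le> f x"
    and lower: "AE x in lebesgue. x \<in> C \<longrightarrow> norm x < \<delta> \<longrightarrow> p * (sin (norm x * t))\<^sup>2 / norm x ^ ?n \<le> f x"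
  \<comment> \<open>The number of full intervals of length \<open>pi\<close> that the phase
    \<open>norm x * t\<close> runs through for \<open>norm x < \<delta>\<close>; rounding down keeps
    all shells inside that ball.\<close>
  define M where "M = nat \<lfloor>\<delta> * t / pi\<rfloor>"
  define a where "a m = (real m * pi + pi / 6) / t" for m
  define b where "b m = (real m * pi + 5 * pi / 6) / t" for m
  define S where "S m = C \<inter> ball 0 (b m) - C \<inter> ball 0 (a m)" for m
  have a0: "a m > 0" and ab: "a m < b m" for m
    using t by (auto simp: a_def b_def divide_simps add_nonneg_pos)
  have b0: "b m > 0" for m
    using a0 ab less_trans by blast
  have b\<delta>: "b m \<le> \<delta>" if "m < M" for m
  proof -
    have "real m + 1 \<le> real M"
      using that by simp
    also have "real M \<le> \<delta> * t / pi"
      unfolding M_def using \<delta> t by (simp add: of_nat_floor)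
    finally have "(real m + 1) * pi \<le> \<delta> * t"
      by (simp add: field_simps)
    then have "real m * pi + 5 * pi / 6 \<le> \<delta> * t"
      using pi_gt_zero unfolding distrib_right by linarith
    then show ?thesis
      using t by (simp add: b_def divide_simps)
  qed
  have S_bounds: "real m * pi + pi / 6 \<le> norm x * t" "norm x * t \<le> real m * pi + 5 * pi / 6"
    "norm x < b m" "0 < norm x" "x \<in> C" if "x \<in> S m" for x m
  proof -
    have "a m \<le> norm x" "norm x < b m" "x \<in> C"
      using that by (auto simp: S_def)
    then show "real m * pi + pi / 6 \<le> norm x * t" "norm x * t \<le> real m * pi + 5 * pi / 6"
      "norm x < b m" "0 < norm x" "x \<in> C"
      using t a0[of m] by (auto simp: a_def b_def field_simps)
  qed
  \<comment> \<open>The shell index can be read off from the point, so the shells are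
    disjoint.\<close>
  have S_index: "m = nat \<lfloor>norm x * t / pi\<rfloor>" if "x \<in> S m" for x m
  proof -
    have "real m * pi \<le> norm x * t" "norm x * t < (real m + 1) * pi"
      using S_bounds(1,2)[OF that] pi_gt_zero unfolding distrib_right by linarith+
    then have "\<lfloor>norm x * t / pi\<rfloor> = int m"
      by (intro floor_unique) (auto simp: pos_le_divide_eq pos_divide_less_eq)
    then show ?thesis
      by simp
  qed
  have S_meas: "S m \<in> lmeasurable" for m
    unfolding S_def by (intro fmeasurable.Diff lm)
  have S_int: "integrable lebesgue (indicator (S m) :: 'a \<Rightarrow> real)" for m
    using S_meas[of m] unfolding fmeasurable_def by (intro integrable_real_indicator) blast+
  have measure_S: "measure lebesgue (S m) = (b m ^ ?n - a m ^ ?n) * \<mu>" for m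
  proof -
    have "measure lebesgue (S m) = measure lebesgue (C \<inter> ball 0 (b m)) - measure lebesgue (C \<inter> ball 0 (a m))"
      unfolding S_def using lm ab[of m]
      by (intro measurable_measure_Diff) (auto simp: fmeasurableD)
    then show ?thesis
      using scale[OF a0] scale[OF b0] by (simp add: algebra_simps)
  qed
  \<comment> \<open>A step function below \<open>f\<close>: on the \<open>m\<close>-th shell
    \<open>sin^2\<close> is at least 1/4 and \<open>norm x\<close> is at most the outer radius
    \<open>b m\<close>.\<close>
  define h where "h = (\<lambda>x. \<Sum>m<M. (p / 4 / b m ^ ?n) * indicator (S m) x)"
  have h: "integrable lebesgue h"
    unfolding h_def
    by (intro Bochner_Integration.integrable_sum integrable_mult_right S_int)
  have "AE x in lebesgue. h x \<le> f x"
    using lower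
  proof eventually_elim
    fix x
    assume lower: "x \<in> C \<longrightarrow> norm x < \<delta> \<longrightarrow> p * (sin (norm x * t))\<^sup>2 / norm x ^ ?n \<le> f x"
    show "h x \<le> f x"
    proof (cases "\<exists>m<M. x \<in> S m")
      case True
      then obtain m where m: "m < M" "x \<in> S m"
        by blast
      have uniq: "i = m" if "x \<in> S i" for i
        using S_index[OF that] S_index[OF m(2)] by simp
      have "h x = (\<Sum>i<M. if i = m then p / 4 / b m ^ ?n else 0)"
        unfolding h_def
      proof (intro sum.cong refl)
        show "p / 4 / b i ^ ?n * indicator (S i) x = (if i = m then p / 4 / b m ^ ?n else 0)" for i
          using m(2) uniq[of i] by (cases "x \<in> S i") (auto simp: indicator_def)
      qed
      also have "\<dots> = p * (1 / 4) / b m ^ ?n"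
        using m by simp
      also have "\<dots> \<le> p * (sin (norm x * t))\<^sup>2 / norm x ^ ?n"
        using S_bounds[OF m(2)] p
        by (intro frac_le mult_left_mono sin_squared_ge_quarter[of m] power_mono) auto
      also have "\<dots> \<le> f x"
        using lower S_bounds[OF m(2)] b\<delta>[OF m(1)] by auto
      finally show ?thesis .
    next
      case False
      then have "h x = 0"
        by (auto simp: h_def indicator_def)
      then show ?thesis
        using f by simp
    qed
  qed
  then have le: "(LINT x|lebesgue. h x) \<le> (LINT x|lebesgue. f x)"
    by (intro integral_mono_AE h f)
  have y: "0 < \<delta> * t / pi"
    using \<delta> t by simp
  then have "real M = real_of_int \<lfloor>\<delta> * t / pi\<rfloor>"
    unfolding M_def by simp
  \<comment> \<open>Rounding loses less than one, which the inequality
    \<open>ln (M + 1) \<le> harm M\<close> absorbs; this also covers \<open>M = 0\<close>.\<close>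
  then have "\<delta> * t / pi \<le> real M + 1"
    by linarith
  then have "ln (\<delta> * t / pi) \<le> ln (real M + 1)"
    using y by (intro ln_mono) auto
  also have "\<dots> \<le> harm M"
    by (rule ln_le_harm)
  finally have "\<mu> / 6 * p * ln (\<delta> * t / pi) \<le> \<mu> / 6 * p * harm M"
    using \<mu> p by (intro mult_left_mono) auto
  also have "harm M = (\<Sum>m<M. 1 / (real m + 1))"
    by (induction M) (auto simp: harm_Suc harm_expand inverse_eq_divide add_ac)
  also have "\<mu> / 6 * p * (\<Sum>m<M. 1 / (real m + 1)) = (\<Sum>m<M. \<mu> / 6 * p * (1 / (real m + 1)))"
    by (rule sum_distrib_left)
  also have "\<dots> \<le> (\<Sum>m<M. p / 4 / b m ^ ?n * measure lebesgue (S m))"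
  proof (rule sum_mono)
    fix m
    \<comment> \<open>The shell fills the fraction \<open>1 - (a m / b m) ^ ?n\<close> of the cone
      up to radius \<open>b m\<close>. As the ratio is below 1 and the dimension at least 1, this is
      at least \<open>1 - a m / b m\<close>, a bound free of both the dimension and
      \<open>t\<close>.\<close>
    have "(a m / b m) ^ ?n \<le> (a m / b m) ^ 1"
      using a0[of m] ab[of m] b0[of m] by (intro power_decreasing) (auto simp: Suc_leI)
    also have "(a m / b m) ^ 1 = 1 - 2 / 3 / (real m + 5 / 6)"
    proof -
      have "real m * pi + 5 * pi / 6 = pi * (real m + 5 / 6)" "real m * pi + pi / 6 = pi * (real m + 1 / 6)"
        by (auto simp: algebra_simps)
      then have "a m / b m = (real m + 1 / 6) / (real m + 5 / 6)"
        using t by (simp add: a_def b_def)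
      also have "\<dots> = 1 - 2 / 3 / (real m + 5 / 6)"
        by (simp add: divide_simps) (simp add: algebra_simps)
      finally show ?thesis
        by simp
    qed
    also have "\<dots> \<le> 1 - 2 / 3 / (real m + 1)"
      by (intro diff_left_mono divide_left_mono) (auto intro!: mult_pos_pos add_nonneg_pos)
    finally have "2 / 3 * (1 / (real m + 1)) \<le> 1 - (a m / b m) ^ ?n"
      by simp
    then have "\<mu> * p / 4 * (2 / 3 * (1 / (real m + 1))) \<le> \<mu> * p / 4 * (1 - (a m / b m) ^ ?n)"
      using \<mu> p by (intro mult_left_mono) auto
    also have "1 - (a m / b m) ^ ?n = (b m ^ ?n - a m ^ ?n) / b m ^ ?n"
      using b0[of m] by (simp add: power_divide field_simps)
    finally show "\<mu> / 6 * p * (1 / (real m + 1)) \<le> p / 4 / b m ^ ?n * measure lebesgue (S m)"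
      unfolding measure_S by (simp add: mult_ac)
  qed
  also have "\<dots> = (LINT x|lebesgue. h x)"
    unfolding h_def
    by (subst Bochner_Integration.integral_sum) (simp_all add: S_int)
  also note le
  finally show "\<mu> / 6 * p * ln (\<delta> * t / pi) \<le> (LINT x|lebesgue. f x)" .
qed

section \<open>Taylor expansion of the Fourier transform\<close>

context finite_moments
begin

lemma norm_mixed_moment_le:
  assumes "j + multi_order \<beta> \<le> k"
  shows "norm (mixed_moment g j v \<beta>) \<le> norm v ^ j * (LINT x|lebesgue. (1 + norm x) ^ k * norm (g x))"
proof -
  have "norm (mixed_moment g j v \<beta>) \<le> (LINT x|lebesgue. norm v ^ j * ((1 + norm x) ^ k * norm (g x)))"
    unfolding mixed_moment_def
    by (intro Bochner_Integration.integral_norm_bound_integral integrable_mixed norm_mixed_integrand_le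
          integrable_mult_right integrable_weight assms)
  then show ?thesis
    by simp
qed

lemma continuous_on_mixed_moment:
  assumes "j + multi_order \<beta> \<le> k"
  shows "continuous_on UNIV (\<lambda>v. mixed_moment g j v \<beta>)"
  unfolding mixed_moment_def
proof (rule continuous_on_parametric_integral)
  show "(\<lambda>x. ((x \<bullet> v) ^ j * (\<Prod>i\<in>UNIV. (x $ i) ^ \<beta> i)) *\<^sub>R g x) \<in> borel_measurable lebesgue" for v
    by measurable
  show "continuous_on UNIV (\<lambda>v. ((x \<bullet> v) ^ j * (\<Prod>i\<in>UNIV. (x $ i) ^ \<beta> i)) *\<^sub>R g x)" for x
    by (intro continuous_intros)
  show "integrable lebesgue (\<lambda>x. R ^ j * ((1 + norm x) ^ k * norm (g x)))" for R
    by (intro integrable_mult_right integrable_weight)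
  show "norm (((x \<bullet> v) ^ j * (\<Prod>i\<in>UNIV. (x $ i) ^ \<beta> i)) *\<^sub>R g x) \<le> R ^ j * ((1 + norm x) ^ k * norm (g x))"
    if "norm v \<le> R" for R v x
  proof -
    have "norm v ^ j * ((1 + norm x) ^ k * norm (g x)) \<le> R ^ j * ((1 + norm x) ^ k * norm (g x))"
      using that by (intro mult_right_mono power_mono) auto
    with norm_mixed_integrand_le[OF assms] show ?thesis
      by (rule order_trans)
  qed
qed

text \<open>The Taylor remainder of the exponential at \<open>y = - (x \<bullet> \<xi>)\<close> is
  at most \<open>\<bar>y\<bar> ^ Suc m\<close>, and integrating it against \<open>g\<close> costs a
  moment of order \<open>Suc m\<close>.\<close>

lemma norm_fourier_taylor_le:
  assumes "Suc m \<le> k"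
  shows "norm ((LINT x|lebesgue. cis (- (x \<bullet> \<xi>)) * g x)
             - (\<Sum>j\<le>m. (- \<i>) ^ j / fact j * mixed_moment g j \<xi> (\<lambda>_. 0)))
         \<le> norm \<xi> ^ Suc m * (LINT x|lebesgue. (1 + norm x) ^ k * norm (g x))"
proof -
  let ?T = "\<lambda>j x. ((- \<i>) ^ j / fact j) * ((x \<bullet> \<xi>) ^ j *\<^sub>R g x)"
  have int_pow: "integrable lebesgue (\<lambda>x. (x \<bullet> \<xi>) ^ j *\<^sub>R g x)" if "j \<le> k" for j
    using integrable_mixed[of j "\<lambda>_. 0" \<xi>] that by (simp add: multi_order_def)
  have int_T: "integrable lebesgue (?T j)" if "j \<le> m" for j
    using that assms by (intro integrable_mult_right int_pow) auto
  then have int_sum: "integrable lebesgue (\<lambda>x. \<Sum>j\<le>m. ?T j x)"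
    by (intro Bochner_Integration.integrable_sum) simp
  have integral_sum_T: "(LINT x|lebesgue. (\<Sum>j\<le>m. ?T j x)) = (\<Sum>j\<le>m. LINT x|lebesgue. ?T j x)"
    by (rule Bochner_Integration.integral_sum, rule int_T) simp
  have "integrable lebesgue g"
    using int_pow[of 0] by simp
  then have int_cis: "integrable lebesgue (\<lambda>x. cis (- (x \<bullet> \<xi>)) * g x)"
    by (rule Bochner_Integration.integrable_bound) auto
  have "(- \<i>) ^ j / fact j * mixed_moment g j \<xi> (\<lambda>_. 0) = (LINT x|lebesgue. ?T j x)" for j
    by (simp only: mixed_moment_def integral_mult_right_zero power_0 prod.neutral_const mult_1_right)
  then have "(LINT x|lebesgue. cis (- (x \<bullet> \<xi>)) * g x) - (\<Sum>j\<le>m. (- \<i>) ^ j / fact j * mixed_moment g j \<xi> (\<lambda>_. 0))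
      = (LINT x|lebesgue. cis (- (x \<bullet> \<xi>)) * g x) - (\<Sum>j\<le>m. LINT x|lebesgue. ?T j x)"
    by (simp only:)
  also have "\<dots> = (LINT x|lebesgue. cis (- (x \<bullet> \<xi>)) * g x - (\<Sum>j\<le>m. ?T j x))"
    by (simp only: Bochner_Integration.integral_diff[OF int_cis int_sum] integral_sum_T)
  also have "norm \<dots> \<le> (LINT x|lebesgue. norm \<xi> ^ Suc m * ((1 + norm x) ^ k * norm (g x)))"
  proof (rule Bochner_Integration.integral_norm_bound_integral)
    fix x :: "real ^ 'n"
    define y where "y = - (x \<bullet> \<xi>)"
    have "(- \<i>) ^ j * (x \<bullet> \<xi>) ^ j = (\<i> * y) ^ j" for j
      by (simp add: y_def flip: power_mult_distrib)
    then have "cis (- (x \<bullet> \<xi>)) * g x - (\<Sum>j\<le>m. ?T j x) = (iexp y - (\<Sum>j\<le>m. (\<i> * y) ^ j / fact j)) * g x"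
      by (simp add: right_diff_distrib sum_distrib_left cis_conv_exp y_def scaleR_conv_of_real mult_ac
            flip: of_real_power)
    then have "norm (cis (- (x \<bullet> \<xi>)) * g x - (\<Sum>j\<le>m. ?T j x))
        \<le> \<bar>y\<bar> ^ Suc m / fact (Suc m) * norm (g x)"
      using iexp_approx1[of y m] by (simp only: norm_mult) (rule mult_right_mono, auto)
    also have "\<dots> \<le> \<bar>y\<bar> ^ Suc m * norm (g x)"
    proof (rule mult_right_mono)
      have "\<bar>y\<bar> ^ Suc m / fact (Suc m) \<le> \<bar>y\<bar> ^ Suc m / 1"
        by (intro divide_left_mono fact_ge_1) auto
      then show "\<bar>y\<bar> ^ Suc m / fact (Suc m) \<le> \<bar>y\<bar> ^ Suc m"
        by simp
    qed simp
    also have "\<dots> = norm (((x \<bullet> \<xi>) ^ Suc m * (\<Prod>i\<in>UNIV. (x $ i) ^ 0)) *\<^sub>R g x)"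
      by (simp add: y_def abs_mult power_abs)
    also have "\<dots> \<le> norm \<xi> ^ Suc m * ((1 + norm x) ^ k * norm (g x))"
      using assms by (intro norm_mixed_integrand_le) (simp add: multi_order_def)
    finally show "norm (cis (- (x \<bullet> \<xi>)) * g x - (\<Sum>j\<le>m. ?T j x))
        \<le> norm \<xi> ^ Suc m * ((1 + norm x) ^ k * norm (g x))" .
  next
    show "integrable lebesgue (\<lambda>x. cis (- (x \<bullet> \<xi>)) * g x - (\<Sum>j\<le>m. ?T j x))"
      by (rule Bochner_Integration.integrable_diff[OF int_cis int_sum])
    show "integrable lebesgue (\<lambda>x. norm \<xi> ^ Suc m * ((1 + norm x) ^ k * norm (g x)))"
      by (intro integrable_mult_right integrable_weight)
  qed
  finally show ?thesis
    by simp
qed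

end

section \<open>Leading term of the Fourier transform at the origin\<close>

lemma mixed_moment_scaleR:
  "mixed_moment g j (r *\<^sub>R v) \<beta> = r ^ j *\<^sub>R mixed_moment g j v \<beta>"
proof -
  have "mixed_moment g j (r *\<^sub>R v) \<beta>
     = (LINT x|lebesgue. r ^ j *\<^sub>R (((x \<bullet> v) ^ j * (\<Prod>i\<in>UNIV. (x $ i) ^ \<beta> i)) *\<^sub>R g x))"
    by (simp add: mixed_moment_def power_mult_distrib mult_ac)
  then show ?thesis
    by (simp only: mixed_moment_def integral_scaleR_right)
qed

text \<open>Finite moments are required one order above the leading order \<open>m\<close>, to pay
  for the Taylor remainder.\<close>

locale leading_moment = finite_moments g "Suc m" for g :: "real ^ 'n \<Rightarrow> complex" and m +
  assumes lower_moments: "\<And>\<alpha>. multi_order \<alpha> < m \<Longrightarrow> moment \<alpha> g = 0"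
    and leading_moment: "\<exists>\<alpha>. multi_order \<alpha> = m \<and> moment \<alpha> g \<noteq> 0"
begin

text \<open>\<open>W\<close> is the constant of the Taylor remainder, \<open>\<gamma>\<close> the
  normalization of \<open>fourier_integral\<close>, and \<open>Q\<close> the leading Taylor term up
  to a nonzero constant factor.\<close>

definition W where "W = (LINT x|lebesgue. (1 + norm x) ^ Suc m * norm (g x))"
definition \<gamma> where "\<gamma> = (2 * pi) powr (- real CARD('n) / 2)"
definition Q where "Q \<xi> = mixed_moment g m \<xi> (\<lambda>_. 0)"

lemma W_nonneg: "W \<ge> 0"
  unfolding W_def by (intro Bochner_Integration.integral_nonneg) auto

lemma \<gamma>_pos: "\<gamma> > 0"
  unfolding \<gamma>_def by simp

lemma norm_fourier_integral_diff_le: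
  "norm (fourier_integral g \<xi> - \<gamma> *\<^sub>R ((- \<i>) ^ m / fact m * Q \<xi>)) \<le> \<gamma> * (W * norm \<xi> ^ Suc m)"
proof -
  have "mixed_moment g j \<xi> (\<lambda>_. 0) = 0" if "j < m" for j
    using that lower_moments by (intro mixed_moment_eq_0) (auto simp: multi_order_def)
  then have "(\<Sum>j\<le>m. (- \<i>) ^ j / fact j * mixed_moment g j \<xi> (\<lambda>_. 0)) = (- \<i>) ^ m / fact m * Q \<xi>"
    by (simp add: Q_def flip: lessThan_Suc_atMost)
  then have "norm ((LINT x|lebesgue. cis (- (x \<bullet> \<xi>)) * g x) - (- \<i>) ^ m / fact m * Q \<xi>) \<le> W * norm \<xi> ^ Suc m"
    using norm_fourier_taylor_le[of m \<xi>] by (simp add: W_def mult_ac)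
  moreover have "fourier_integral g \<xi> - \<gamma> *\<^sub>R ((- \<i>) ^ m / fact m * Q \<xi>)
      = \<gamma> *\<^sub>R ((LINT x|lebesgue. cis (- (x \<bullet> \<xi>)) * g x) - (- \<i>) ^ m / fact m * Q \<xi>)"
    by (simp only: fourier_integral_def \<gamma>_def scaleR_diff_right)
  ultimately show ?thesis
    using \<gamma>_pos by simp
qed

lemma norm_leading_term: "norm (\<gamma> *\<^sub>R ((- \<i>) ^ m / fact m * Q \<xi>)) = \<gamma> * (norm (Q \<xi>) / fact m)"
  using \<gamma>_pos by (simp add: norm_mult norm_divide norm_power)

text \<open>In the unit ball the remainder of order \<open>Suc m\<close> is dominated by order
  \<open>m\<close>. The bound serves the integrability of the velocity part near the origin.\<close>

lemma norm_fourier_integral_le: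
  assumes "norm \<xi> \<le> 1"
  shows "norm (fourier_integral g \<xi>) \<le> 2 * \<gamma> * W * norm \<xi> ^ m"
proof -
  have "norm (Q \<xi>) \<le> norm \<xi> ^ m * W"
    unfolding Q_def W_def by (intro norm_mixed_moment_le) (simp add: multi_order_def)
  moreover have "norm (Q \<xi>) / fact m \<le> norm (Q \<xi>) / 1"
    by (intro divide_left_mono fact_ge_1) auto
  ultimately have "\<gamma> * (norm (Q \<xi>) / fact m) \<le> \<gamma> * (norm \<xi> ^ m * W)"
    using \<gamma>_pos by (intro mult_left_mono) auto
  moreover have "\<gamma> * (W * norm \<xi> ^ Suc m) \<le> \<gamma> * (W * norm \<xi> ^ m)"
    using \<gamma>_pos W_nonneg assms by (intro mult_left_mono power_decreasing) auto
  ultimately show ?thesis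
    using norm_fourier_integral_diff_le[of \<xi>] norm_leading_term[of \<xi>]
      norm_triangle_sub[of "fourier_integral g \<xi>" "\<gamma> *\<^sub>R ((- \<i>) ^ m / fact m * Q \<xi>)"]
    by (simp add: mult_ac)
qed

text \<open>The cone is the set where \<open>norm (Q \<xi>)\<close> exceeds
  \<open>q * norm \<xi> ^ m\<close>: open by continuity, and dilation invariant because
  \<open>Q\<close> is homogeneous of degree \<open>m\<close>.\<close>

lemma fourier_integral_lower_bound_cone:
  obtains C \<delta> q where "open C" "C \<noteq> {}" "\<And>r \<xi>. r > 0 \<Longrightarrow> \<xi> \<in> C \<Longrightarrow> r *\<^sub>R \<xi> \<in> C"
    and "\<delta> > 0" "q > 0" "\<And>\<xi>. \<xi> \<in> C \<Longrightarrow> norm \<xi> < \<delta> \<Longrightarrow> q * norm \<xi> ^ m \<le> norm (fourier_integral g \<xi>)"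
proof -
  obtain e where e: "Q e \<noteq> 0"
    using leading_moment moment_eq_0_of_directional[of m] unfolding Q_def by (metis le_SucI order_refl)
  \<comment> \<open>The added 1 makes the inequality strict at \<open>e\<close>, so that
    \<open>e\<close> lies in the cone, and keeps the denominator positive.\<close>
  define q where "q = norm (Q e) / (1 + norm e ^ m)"
  have q: "q > 0"
    unfolding q_def using e by (intro divide_pos_pos add_pos_nonneg) auto
  have "q * norm e ^ m < norm (Q e)"
    unfolding q_def using e by (simp add: divide_simps add_pos_nonneg algebra_simps)
  then have C_ne: "{\<xi>. q * norm \<xi> ^ m < norm (Q \<xi>)} \<noteq> {}"
    by blast
  have "continuous_on UNIV Q"
    unfolding Q_def [abs_def] by (intro continuous_on_mixed_moment) (simp add: multi_order_def)
  then have C_open: "open {\<xi>. q * norm \<xi> ^ m < norm (Q \<xi>)}"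
    by (intro open_Collect_less continuous_intros)
  have C_cone: "r *\<^sub>R \<xi> \<in> {\<xi>. q * norm \<xi> ^ m < norm (Q \<xi>)}"
    if "r > 0" "\<xi> \<in> {\<xi>. q * norm \<xi> ^ m < norm (Q \<xi>)}" for r \<xi>
  proof -
    have "r ^ m * (q * norm \<xi> ^ m) < r ^ m * norm (Q \<xi>)"
      using that by (intro mult_strict_left_mono) auto
    then show ?thesis
      using that by (simp add: Q_def mixed_moment_scaleR power_mult_distrib mult_ac)
  qed
  \<comment> \<open>Chosen so that for \<open>norm \<xi> < \<delta>\<close> the remainder takes at
    most half of the lower bound \<open>q * norm \<xi> ^ m / fact m\<close> for the leading
    term.\<close>
  define \<delta> where "\<delta> = q / (2 * fact m) / (1 + W)"
  have \<delta>: "\<delta> > 0"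
    unfolding \<delta>_def using q W_nonneg by (intro divide_pos_pos) auto
  have "\<gamma> * q / (2 * fact m) * norm \<xi> ^ m \<le> norm (fourier_integral g \<xi>)"
    if "\<xi> \<in> {\<xi>. q * norm \<xi> ^ m < norm (Q \<xi>)}" "norm \<xi> < \<delta>" for \<xi>
  proof -
    have "W * norm \<xi> \<le> (1 + W) * \<delta>"
      using W_nonneg that by (intro mult_mono) auto
    also have "\<dots> = q / (2 * fact m)"
      using W_nonneg by (simp add: \<delta>_def)
    finally have "W * norm \<xi> * norm \<xi> ^ m \<le> q / (2 * fact m) * norm \<xi> ^ m"
      by (rule mult_right_mono) simp
    then have "W * norm \<xi> ^ Suc m \<le> q / (2 * fact m) * norm \<xi> ^ m"
      by (simp add: mult.assoc)
    moreover have "q * norm \<xi> ^ m / fact m \<le> norm (Q \<xi>) / fact m"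
      using that by (intro divide_right_mono) auto
    ultimately have "q / (2 * fact m) * norm \<xi> ^ m \<le> norm (Q \<xi>) / fact m - W * norm \<xi> ^ Suc m"
      by (simp add: field_simps)
    then have "\<gamma> * (q / (2 * fact m) * norm \<xi> ^ m) \<le> \<gamma> * (norm (Q \<xi>) / fact m - W * norm \<xi> ^ Suc m)"
      using \<gamma>_pos by (intro mult_left_mono) auto
    also have "\<dots> \<le> norm (fourier_integral g \<xi>)"
      using norm_fourier_integral_diff_le[of \<xi>] norm_leading_term[of \<xi>]
        norm_triangle_sub[of "\<gamma> *\<^sub>R ((- \<i>) ^ m / fact m * Q \<xi>)" "fourier_integral g \<xi>"]
      by (simp add: norm_minus_commute right_diff_distrib)
    finally show ?thesis
      by simp
  qed
  moreover have "\<gamma> * q / (2 * fact m) > 0"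
    using \<gamma>_pos q by simp
  ultimately show ?thesis
    using that[OF C_open C_ne C_cone \<delta>] by blast
qed

end

section \<open>Growth of the wave\<close>

text \<open>The condition \<open>2 + 2 * s = 2 * m + n\<close> makes the multiplier \<open>norm \<xi> powr (- 1 - s)\<close>
  square to an integer power, so no real powers occur in the estimates.\<close>

lemma norm_wave_multiplier_squared:
  fixes \<xi> :: "'a::real_normed_vector" and v :: complex
  assumes "\<xi> \<noteq> 0" "2 + 2 * s = real (2 * m + n)"
  shows "(norm ((sin y / norm \<xi>) *\<^sub>R v))\<^sup>2
           = (sin y)\<^sup>2 * (norm ((norm \<xi> powr s) *\<^sub>R v))\<^sup>2 / norm \<xi> ^ (2 * m + n)"
proof -
  have "norm \<xi> ^ (2 * m + n) = norm \<xi> powr (2 + 2 * s)"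
    using assms powr_realpow[of "norm \<xi>" "2 * m + n"] by simp
  also have "\<dots> = norm \<xi> powr 2 * (norm \<xi> powr s * norm \<xi> powr s)"
    by (simp only: powr_add mult_2)
  also have "\<dots> = (norm \<xi>)\<^sup>2 * (norm \<xi> powr s)\<^sup>2"
    using assms by (simp add: power2_eq_square)
  finally show ?thesis
    using assms by (simp add: power_mult_distrib power_divide)
qed

text \<open>Needed although only a lower bound is claimed: \<open>L2_norm\<close> of a function outside \<open>L2\<close> is 0.\<close>

lemma (in leading_moment) integrable_wave_multiplier:
  assumes F: "integrable lebesgue (\<lambda>\<xi>. (norm (F \<xi>))\<^sup>2)"
    and eq: "AE \<xi> in lebesgue. F \<xi> = fourier_integral g \<xi>"
    and g: "integrable lebesgue g"
  shows "integrable lebesgue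
    (\<lambda>\<xi>. (sin (norm \<xi> * t))\<^sup>2 * (norm (fourier_integral g \<xi>))\<^sup>2 / norm \<xi> ^ (2 * m + CARD('n)))"
    (is "integrable _ ?f")
proof (rule Bochner_Integration.integrable_bound)
  let ?K = "(2 * \<gamma> * W * t)\<^sup>2"
  \<comment> \<open>Outside the unit ball the denominator is at least 1 and the first summand
    suffices. Inside it, \<open>\<bar>sin y\<bar> \<le> \<bar>y\<bar>\<close> and the bound of order
    \<open>m\<close> on the transform leave a multiple of
    \<open>norm \<xi> ^ 2 / norm \<xi> ^ n\<close> with \<open>n\<close> the dimension.\<close>
  let ?b = "\<lambda>\<xi> :: real ^ 'n. (norm (F \<xi>))\<^sup>2 + ?K * (indicator (cball 0 1) \<xi> / norm \<xi> ^ (CARD('n) - 1))"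
  show "integrable lebesgue ?b"
    using integrable_inverse_norm_power_unit_ball[where 'a = "real ^ 'n", of "CARD('n) - 1"]
    by (intro Bochner_Integration.integrable_add F integrable_mult_right) simp
  have "fourier_integral g \<in> borel_measurable borel"
    by (intro borel_measurable_continuous_onI continuous_on_fourier_integral g)
  then show "?f \<in> borel_measurable lebesgue"
    by (intro measurable_completion) simp
  have "AE \<xi> :: real ^ 'n in lebesgue. \<xi> \<notin> {0}"
    by (rule AE_not_in) simp
  with eq show "AE \<xi> in lebesgue. norm (?f \<xi>) \<le> norm (?b \<xi>)"
  proof eventually_elim
    fix \<xi> :: "real ^ 'n"
    assume F\<xi>: "F \<xi> = fourier_integral g \<xi>" and "\<xi> \<notin> {0}"
    then have pos: "norm \<xi> > 0"
      by simp
    have "?f \<xi> \<le> ?b \<xi>"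
    proof (cases "norm \<xi> \<le> 1")
      case True
      have "(norm (fourier_integral g \<xi>))\<^sup>2 \<le> (2 * \<gamma> * W * norm \<xi> ^ m)\<^sup>2"
        using norm_fourier_integral_le[OF True] by (intro power_mono) auto
      moreover have "(sin (norm \<xi> * t))\<^sup>2 \<le> (norm \<xi> * t)\<^sup>2"
        using abs_sin_x_le_abs_x by (simp add: abs_le_square_iff)
      ultimately have "?f \<xi> \<le> (norm \<xi> * t)\<^sup>2 * (2 * \<gamma> * W * norm \<xi> ^ m)\<^sup>2 / norm \<xi> ^ (2 * m + CARD('n))"
        by (intro divide_right_mono mult_mono) auto
      also have "\<dots> = ?K * ((norm \<xi>)\<^sup>2 / norm \<xi> ^ CARD('n))"
        using pos by (simp add: power_mult_distrib power_add field_simps flip: power_mult)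
      \<comment> \<open>One power is given away: the exponent \<open>n - 1\<close> is a natural
        number also in dimension 1 and still below the dimension.\<close>
      also have "\<dots> \<le> ?K * (norm \<xi> / norm \<xi> ^ CARD('n))"
      proof (intro mult_left_mono divide_right_mono)
        show "(norm \<xi>)\<^sup>2 \<le> norm \<xi>"
          using True by (simp add: power2_eq_square mult_left_le)
      qed auto
      also have "norm \<xi> / norm \<xi> ^ CARD('n) = 1 / norm \<xi> ^ (CARD('n) - 1)"
        using pos by (subst power_eq_if) simp
      finally have "?f \<xi> \<le> ?K * (1 / norm \<xi> ^ (CARD('n) - 1))" .
      moreover have "indicator (cball 0 1) \<xi> = (1 :: real)"
        using True by simp
      ultimately have "?f \<xi> \<le> ?K * (indicator (cball 0 1) \<xi> / norm \<xi> ^ (CARD('n) - 1))"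
        by simp
      then show ?thesis
        by (rule add_increasing[OF zero_le_power2])
    next
      case False
      have "(sin (norm \<xi> * t))\<^sup>2 * (norm (fourier_integral g \<xi>))\<^sup>2 \<le> 1 * (norm (fourier_integral g \<xi>))\<^sup>2"
        by (intro mult_right_mono) (auto simp: abs_square_le_1)
      moreover have "1 \<le> norm \<xi> ^ (2 * m + CARD('n))"
        using False by (intro one_le_power) auto
      ultimately have "?f \<xi> \<le> (norm (fourier_integral g \<xi>))\<^sup>2 / 1"
        by (intro frac_le) auto
      then show ?thesis
        using False F\<xi> by simp
    qed
    moreover have "0 \<le> ?f \<xi>"
      by simp
    ultimately show "norm (?f \<xi>) \<le> norm (?b \<xi>)"
      by simp
  qed
qed

lemma integrable_polynomial_weight:
  assumes g: "g \<in> weighted_L1 \<kappa>" and k: "real k \<le> \<kappa>"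
  shows "integrable lebesgue (\<lambda>x. (1 + norm x) ^ k * norm (g x))"
proof (rule Bochner_Integration.integrable_bound)
  have [measurable]: "g \<in> borel_measurable lebesgue"
    using g by (auto simp: weighted_L1_def)
  show "integrable lebesgue (\<lambda>x. (1 + norm x) powr \<kappa> *\<^sub>R g x)"
    using g by (simp add: weighted_L1_def)
  have "(\<lambda>x. (1 + norm x) ^ k) \<in> borel_measurable lebesgue"
    by (intro borel_measurable_lebesgue_continuous_onI continuous_intros)
  then show "(\<lambda>x. (1 + norm x) ^ k * norm (g x)) \<in> borel_measurable lebesgue"
    by measurable
  show "AE x in lebesgue. norm ((1 + norm x) ^ k * norm (g x)) \<le> norm ((1 + norm x) powr \<kappa> *\<^sub>R g x)"
  proof (rule AE_I2)
    fix x :: "real ^ 'a"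
    have "(1 + norm x) ^ k = (1 + norm x) powr real k"
      by (simp add: powr_realpow add_pos_nonneg)
    also have "\<dots> \<le> (1 + norm x) powr \<kappa>"
      using k by (intro powr_mono) auto
    finally show "norm ((1 + norm x) ^ k * norm (g x)) \<le> norm ((1 + norm x) powr \<kappa> *\<^sub>R g x)"
      by (simp add: mult_right_mono)
  qed
qed

text \<open>Separates the velocity part \<open>b\<close> from the displacement part
  \<open>a\<close>. The lower bound is the upper one applied to
  \<open>b = (a + b) + (- a)\<close>.\<close>

lemma norm_add_squared_bounds:
  fixes a b :: "'a::real_normed_vector"
  shows "(norm b)\<^sup>2 / 2 - (norm a)\<^sup>2 \<le> (norm (a + b))\<^sup>2"
    and "(norm (a + b))\<^sup>2 \<le> 2 * (norm a)\<^sup>2 + 2 * (norm b)\<^sup>2"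
proof -
  have *: "(norm (x + y))\<^sup>2 \<le> 2 * (norm x)\<^sup>2 + 2 * (norm y)\<^sup>2" for x y :: 'a
  proof -
    have "(norm (x + y))\<^sup>2 \<le> (norm x + norm y)\<^sup>2"
      by (intro power_mono norm_triangle_ineq) auto
    also have "\<dots> \<le> 2 * (norm x)\<^sup>2 + 2 * (norm y)\<^sup>2"
      using sum_squares_ge_zero[of "norm x - norm y" 0] by (simp add: power2_eq_square algebra_simps)
    finally show ?thesis .
  qed
  show "(norm (a + b))\<^sup>2 \<le> 2 * (norm a)\<^sup>2 + 2 * (norm b)\<^sup>2"
    by (rule *)
  show "(norm b)\<^sup>2 / 2 - (norm a)\<^sup>2 \<le> (norm (a + b))\<^sup>2"
    using *[of "a + b" "- a"] by simp
qed

text \<open>The constant \<open>b\<close> collects what does not depend on \<open>t\<close>: the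
  squared norm of \<open>u0_hat\<close> and the logarithm of \<open>\<delta> / pi\<close>.\<close>

lemma (in leading_moment) wave_L2_norm_log_lower_bound:
  assumes u0: "u0_hat \<in> L2" and u1: "has_nabla_power s u1_hat g"
    and g: "integrable lebesgue g"
    and s: "2 + 2 * s = real (2 * m + CARD('n))"
  obtains a b where "a > 0" "\<And>t. t > 0 \<Longrightarrow> a * ln t + b \<le> (L2_norm (wave_hat u0_hat u1_hat t))\<^sup>2"
proof -
  define F where "F = (\<lambda>\<xi>. (norm \<xi> powr s) *\<^sub>R u1_hat \<xi>)"
  \<comment> \<open>The squared velocity part, up to a null set, with the continuous Fourier
    integral in place of \<open>u1_hat\<close>; pointwise bounds near the origin apply to this
    form.\<close>
  define f where "f t \<xi> = (sin (norm \<xi> * t))\<^sup>2 * (norm (fourier_integral g \<xi>))\<^sup>2 / norm \<xi> ^ (2 * m + CARD('n))"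
    for t and \<xi> :: "real ^ 'n"
  have F: "has_fourier_transform g F" and [measurable]: "u1_hat \<in> borel_measurable lebesgue"
    using u1 by (auto simp: has_nabla_power_def F_def)
  have [measurable]: "u0_hat \<in> borel_measurable lebesgue"
    and u0_int: "integrable lebesgue (\<lambda>\<xi>. (norm (u0_hat \<xi>))\<^sup>2)"
    using u0 by (auto simp: L2_def)
  have F_eq: "AE \<xi> in lebesgue. F \<xi> = fourier_integral g \<xi>"
    by (rule has_fourier_transform_integrable_AE[OF F g])
  have f_int: "integrable lebesgue (f t)" for t
    unfolding f_def using F
    by (intro integrable_wave_multiplier[OF _ F_eq g]) (simp add: has_fourier_transform_def L2_def)
  have nz: "AE \<xi> :: real ^ 'n in lebesgue. \<xi> \<notin> {0}"
    by (rule AE_not_in) simp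
  have B_eq: "AE \<xi> in lebesgue. (norm ((sin (norm \<xi> * t) / norm \<xi>) *\<^sub>R u1_hat \<xi>))\<^sup>2 = f t \<xi>" for t
    using F_eq nz
  proof eventually_elim
    case (elim \<xi>)
    then show ?case
      using norm_wave_multiplier_squared[of \<xi> s m "CARD('n)" "norm \<xi> * t" "u1_hat \<xi>"] s
      by (simp add: f_def F_def)
  qed
  have A_le: "(norm (cos y *\<^sub>R z))\<^sup>2 \<le> (norm z)\<^sup>2" for y and z :: complex
    by (intro power_mono) (auto simp: mult_left_le_one_le)
  have wave_meas: "wave_hat u0_hat u1_hat t \<in> borel_measurable lebesgue" for t
  proof -
    have "(\<lambda>\<xi> :: real ^ 'n. cos (norm \<xi> * t)) \<in> borel_measurable lebesgue"
      "(\<lambda>\<xi> :: real ^ 'n. sin (norm \<xi> * t) / norm \<xi>) \<in> borel_measurable lebesgue"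
      by (intro measurable_completion; simp)+
    then show ?thesis
      unfolding wave_hat_def [abs_def] by measurable
  qed
  have wave_int: "integrable lebesgue (\<lambda>\<xi>. (norm (wave_hat u0_hat u1_hat t \<xi>))\<^sup>2)" for t
  proof (rule Bochner_Integration.integrable_bound)
    show "integrable lebesgue (\<lambda>\<xi>. 2 * (norm (u0_hat \<xi>))\<^sup>2 + 2 * f t \<xi>)"
      using u0_int f_int by (intro Bochner_Integration.integrable_add integrable_mult_right)
    show "(\<lambda>\<xi>. (norm (wave_hat u0_hat u1_hat t \<xi>))\<^sup>2) \<in> borel_measurable lebesgue"
      using wave_meas by measurable
    show "AE \<xi> in lebesgue. norm ((norm (wave_hat u0_hat u1_hat t \<xi>))\<^sup>2)
        \<le> norm (2 * (norm (u0_hat \<xi>))\<^sup>2 + 2 * f t \<xi>)"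
      using B_eq[of t]
    proof eventually_elim
      case (elim \<xi>)
      then have "(norm (wave_hat u0_hat u1_hat t \<xi>))\<^sup>2 \<le> 2 * (norm (u0_hat \<xi>))\<^sup>2 + 2 * f t \<xi>"
        using norm_add_squared_bounds(2)[of "cos (norm \<xi> * t) *\<^sub>R u0_hat \<xi>"
            "(sin (norm \<xi> * t) / norm \<xi>) *\<^sub>R u1_hat \<xi>"] A_le[of "norm \<xi> * t" "u0_hat \<xi>"]
        unfolding wave_hat_def by linarith
      then show ?case
        by (auto intro: order_trans[OF _ abs_ge_self])
    qed
  qed
  define U where "U = (LINT \<xi>|lebesgue. (norm (u0_hat \<xi>))\<^sup>2)"
  have L2_sq: "(LINT \<xi>|lebesgue. f t \<xi>) / 2 - U \<le> (L2_norm (wave_hat u0_hat u1_hat t))\<^sup>2" for t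
  proof -
    have "(LINT \<xi>|lebesgue. f t \<xi>) / 2 - U = (LINT \<xi>|lebesgue. f t \<xi> / 2 - (norm (u0_hat \<xi>))\<^sup>2)"
      unfolding U_def using f_int u0_int by simp
    also have "\<dots> \<le> (LINT \<xi>|lebesgue. (norm (wave_hat u0_hat u1_hat t \<xi>))\<^sup>2)"
    proof (rule integral_mono_AE)
      show "AE \<xi> in lebesgue. f t \<xi> / 2 - (norm (u0_hat \<xi>))\<^sup>2 \<le> (norm (wave_hat u0_hat u1_hat t \<xi>))\<^sup>2"
        using B_eq[of t]
      proof eventually_elim
        case (elim \<xi>)
        then show ?case
          using norm_add_squared_bounds(1)[of "(sin (norm \<xi> * t) / norm \<xi>) *\<^sub>R u1_hat \<xi>"
              "cos (norm \<xi> * t) *\<^sub>R u0_hat \<xi>"] A_le[of "norm \<xi> * t" "u0_hat \<xi>"]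
          unfolding wave_hat_def by linarith
      qed
    qed (use f_int u0_int wave_int in auto)
    also have "\<dots> = (L2_norm (wave_hat u0_hat u1_hat t))\<^sup>2"
      unfolding L2_norm_def by (intro real_sqrt_pow2[symmetric] Bochner_Integration.integral_nonneg) auto
    finally show ?thesis .
  qed
  obtain C \<delta> q where C: "open C" "C \<noteq> {}" "\<And>r \<xi>. r > 0 \<Longrightarrow> \<xi> \<in> C \<Longrightarrow> r *\<^sub>R \<xi> \<in> C"
    and \<delta>: "\<delta> > 0" and q: "q > 0"
    and lower: "\<And>\<xi>. \<xi> \<in> C \<Longrightarrow> norm \<xi> < \<delta> \<Longrightarrow> q * norm \<xi> ^ m \<le> norm (fourier_integral g \<xi>)"
    by (rule fourier_integral_lower_bound_cone) blast
  obtain \<nu> where \<nu>: "\<nu> > 0"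
    and log: "\<And>\<delta> t p h. \<lbrakk>\<delta> > 0; t > 0; p \<ge> 0; integrable lebesgue h; \<And>x. 0 \<le> h x;
        AE x in lebesgue. x \<in> C \<longrightarrow> norm x < \<delta> \<longrightarrow> p * (sin (norm x * t))\<^sup>2 / norm x ^ DIM(real ^ 'n) \<le> h x\<rbrakk>
      \<Longrightarrow> \<nu> * p * ln (\<delta> * t / pi) \<le> (LINT x|lebesgue. h x)"
    using cone_log_lower_bound[OF C] by blast
  have f_log: "\<nu> * q\<^sup>2 * ln (\<delta> * t / pi) \<le> (LINT \<xi>|lebesgue. f t \<xi>)" if t: "t > 0" for t
  proof (rule log[OF \<delta> t _ f_int])
    show "AE \<xi> in lebesgue. \<xi> \<in> C \<longrightarrow> norm \<xi> < \<delta> \<longrightarrow>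
        q\<^sup>2 * (sin (norm \<xi> * t))\<^sup>2 / norm \<xi> ^ DIM(real ^ 'n) \<le> f t \<xi>"
      using nz
    proof (eventually_elim, intro impI)
      fix \<xi> :: "real ^ 'n"
      assume \<xi>: "\<xi> \<notin> {0}" "\<xi> \<in> C" "norm \<xi> < \<delta>"
      \<comment> \<open>The \<open>2 * m\<close> powers from the lower bound cancel, and the
        remaining exponent is exactly the dimension, the critical case that produces a
        logarithm.\<close>
      have "q\<^sup>2 * (sin (norm \<xi> * t))\<^sup>2 / norm \<xi> ^ DIM(real ^ 'n)
          = (sin (norm \<xi> * t))\<^sup>2 * (q * norm \<xi> ^ m)\<^sup>2 / norm \<xi> ^ (2 * m + CARD('n))"
        using \<xi> by (simp add: power_mult_distrib power_add field_simps flip: power_mult)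
      also have "\<dots> \<le> f t \<xi>"
        unfolding f_def using lower[OF \<xi>(2,3)] q
        by (intro divide_right_mono mult_left_mono power_mono) auto
      finally show "q\<^sup>2 * (sin (norm \<xi> * t))\<^sup>2 / norm \<xi> ^ DIM(real ^ 'n) \<le> f t \<xi>" .
    qed
  qed (auto simp: f_def)
  show ?thesis
  proof
    show "\<nu> * q\<^sup>2 / 2 > 0"
      using \<nu> q by simp
    fix t :: real
    assume t: "t > 0"
    have "ln (\<delta> * t / pi) = ln t + ln (\<delta> / pi)"
      using t \<delta> by (simp add: ln_mult ln_div)
    then have "\<nu> * q\<^sup>2 / 2 * ln t + (\<nu> * q\<^sup>2 / 2 * ln (\<delta> / pi) - U) = \<nu> * q\<^sup>2 * ln (\<delta> * t / pi) / 2 - U"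
      by (simp add: field_simps)
    also have "\<dots> \<le> (LINT \<xi>|lebesgue. f t \<xi>) / 2 - U"
      using f_log[OF t] by simp
    also have "\<dots> \<le> (L2_norm (wave_hat u0_hat u1_hat t))\<^sup>2"
      by (rule L2_sq)
    finally show "\<nu> * q\<^sup>2 / 2 * ln t + (\<nu> * q\<^sup>2 / 2 * ln (\<delta> / pi) - U) \<le> (L2_norm (wave_hat u0_hat u1_hat t))\<^sup>2" .
  qed
qed

theorem mainTheorem4:
  fixes s \<kappa> :: real
    and u0 u0_hat u1_hat nabla_s_u1 :: "real ^ 'n \<Rightarrow> complex"
  assumes "s \<ge> 0"
    and "real CARD('n) \<le> 2 + 2 * s"
    and "1 + s - real CARD('n) / 2 \<in> \<nat>"
    and "\<kappa> \<ge> 0"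
    and "real_of_int \<lfloor>\<kappa>\<rfloor> = 2 + s - real CARD('n) / 2"
    and "u0 \<in> L2"
    and "has_fourier_transform u0 u0_hat"
    and "has_nabla_power s u1_hat nabla_s_u1"
    and "nabla_s_u1 \<in> L2 \<inter> weighted_L1 \<kappa>"
    and "\<And>\<alpha>. int (multi_order \<alpha>) < \<lfloor>\<kappa>\<rfloor> - 1 \<Longrightarrow> moment \<alpha> nabla_s_u1 = 0"
    and "\<And>\<alpha>. int (multi_order \<alpha>) = \<lfloor>\<kappa>\<rfloor> - 1 \<Longrightarrow> moment \<alpha> nabla_s_u1 \<noteq> 0"
  shows "(\<exists>c T. c > 0 \<and> T > 0 \<and>
            (\<forall>t\<ge>T. L2_norm (wave_hat u0_hat u1_hat t)
                \<ge> c * sqrt (ln t) * moment_vector_norm (nat (\<lfloor>\<kappa>\<rfloor> - 1)) nabla_s_u1)) \<and>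
         filterlim (\<lambda>t. L2_norm (wave_hat u0_hat u1_hat t)) at_top at_top"
proof -
  obtain m :: nat where m: "1 + s - real CARD('n) / 2 = real m"
    using assms(3) by (auto simp: Nats_def)
  have floor_m: "\<lfloor>\<kappa>\<rfloor> = int m + 1"
    using assms(5) m by linarith
  then have "real (Suc m) \<le> \<kappa>"
    by linarith
  \<comment> \<open>The hypothesis on the moments of order \<open>m\<close> is universal; it yields
    a nonzero moment once some multi-index of that order is exhibited.\<close>
  have "multi_order (\<lambda>i. if i = i0 then m else 0) = m" for i0 :: 'n
    by (simp add: multi_order_def)
  then have "\<exists>\<alpha> :: 'n \<Rightarrow> nat. multi_order \<alpha> = m"
    by blast
  then interpret leading_moment nabla_s_u1 m
    using assms(9-11) floor_m integrable_polynomial_weight[OF _ \<open>real (Suc m) \<le> \<kappa>\<close>]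
    by unfold_locales (auto simp: L2_def)
  let ?N = "\<lambda>t. L2_norm (wave_hat u0_hat u1_hat t)"
  obtain a b where a: "a > 0" and ab: "\<And>t. t > 0 \<Longrightarrow> a * ln t + b \<le> (?N t)\<^sup>2"
  proof (rule wave_L2_norm_log_lower_bound)
    show "u0_hat \<in> L2"
      using assms(7) by (simp add: has_fourier_transform_def)
    show "has_nabla_power s u1_hat nabla_s_u1"
      by fact
    show "integrable lebesgue nabla_s_u1"
      using assms(9) by (simp add: weighted_L1_def)
    show "2 + 2 * s = real (2 * m + CARD('n))"
      using m by simp
  qed blast
  \<comment> \<open>From this time on \<open>\<bar>b\<bar>\<close> is at most
    \<open>a / 2 * ln t\<close>, so half of the logarithmic term survives; moreover
    \<open>T \<ge> 1\<close>, which makes \<open>ln t\<close> nonnegative.\<close>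
  define T where "T = exp (2 * \<bar>b\<bar> / a)"
  have N_ge: "sqrt (a / 2) * sqrt (ln t) \<le> ?N t" if "t \<ge> T" for t
  proof -
    have "T > 0"
      by (simp add: T_def)
    then have t: "t > 0"
      using that by linarith
    have "2 * \<bar>b\<bar> / a \<le> ln t"
      using that t by (simp add: T_def ln_ge_iff)
    then have "2 * \<bar>b\<bar> \<le> a * ln t"
      using a by (simp add: field_simps)
    then have "a / 2 * ln t \<le> (?N t)\<^sup>2"
      using ab[OF t] by (simp add: field_simps)
    then have "sqrt (a / 2 * ln t) \<le> ?N t"
      by (intro real_le_lsqrt) (auto simp: L2_norm_def)
    then show ?thesis
      by (simp only: real_sqrt_mult)
  qed
  define P where "P = moment_vector_norm (nat (\<lfloor>\<kappa>\<rfloor> - 1)) nabla_s_u1"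
  have P: "P \<ge> 0"
    unfolding P_def moment_vector_norm_def by (rule L2_set_nonneg)
  show ?thesis
  proof (intro conjI exI allI impI)
    \<comment> \<open>Dividing by \<open>1 + P\<close> absorbs the moment factor, since
      \<open>P / (1 + P) \<le> 1\<close>.\<close>
    show "sqrt (a / 2) / (1 + P) > 0"
      using a P by (intro divide_pos_pos) auto
    show "T > 0"
      by (simp add: T_def)
    fix t
    assume t: "t \<ge> T"
    have "1 \<le> T"
      using a by (simp add: T_def)
    then have "0 \<le> ln t"
      using t by (intro ln_ge_zero) linarith
    then have "sqrt (a / 2) / (1 + P) * sqrt (ln t) * P \<le> sqrt (a / 2) * sqrt (ln t)"
      using a P by (simp add: divide_simps mult_left_mono)
    also have "\<dots> \<le> ?N t"
      by (rule N_ge[OF t])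
    finally show "?N t \<ge> sqrt (a / 2) / (1 + P) * sqrt (ln t) * moment_vector_norm (nat (\<lfloor>\<kappa>\<rfloor> - 1)) nabla_s_u1"
      unfolding P_def .
  next
    \<comment> \<open>Divergence is read off from \<open>N_ge\<close>, where the factor
      \<open>P\<close> does not occur.\<close>
    have "filterlim (\<lambda>t. sqrt (a / 2) * sqrt (ln t)) at_top at_top"
      using a
      by (intro filterlim_tendsto_pos_mult_at_top[OF tendsto_const]
            filterlim_compose[OF sqrt_at_top] ln_at_top) auto
    moreover have "\<forall>\<^sub>F t in at_top. sqrt (a / 2) * sqrt (ln t) \<le> ?N t"
      using eventually_ge_at_top[of T] by eventually_elim (rule N_ge)
    ultimately show "filterlim ?N at_top at_top"
      by (rule filterlim_at_top_mono)
  qed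
qed

end
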